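(* There holds (a) $\displaystyle\sum_{m\geq 1}\sum_{n\geq 0}\frac{q^{2m+n}(-q;q)_m (-q;q)_{m-1}^2 (q^3;q^3)_{m+n-1}}{(-q^3;q^3)_m (q;q)_{m+n-1} (-q;q)_{m+n}^2} =\frac{1}{6} \frac{(-q;q)_\infty (q^3;q^3)_\infty}{(q;q)_\infty (-q^3;q^3)_\infty} +\frac{1}{3} \frac{(q^3;q^3)_\infty}{(-q;q)_\infty (q^2;q^2)_\infty}-\frac{1}{2}.$ (b) $\displaystyle\sum_{m\geq 1}\sum_{n\geq 0}\frac{q^{2m+n}(q;q)_m (-q;q)_{m-1}^2 (-q^3;q^3)_{m+n-1}}{(q^3;q^3)_m (-q;q)_{m+n-1} (-q;q)_{m+n}^2} =\frac{-1}{2} \frac{(q;q)_\infty (-q^3;q^3)_\infty}{(-q;q)_\infty (q^3;q^3)_\infty} +\frac{1}{3} \frac{(-q^3;q^3)_\infty}{(-q;q)_\infty^3}+\frac{1}{6}.$ (c) $\displaystyle\sum_{m\geq 1}\sum_{n\geq 0}\frac{q^{2m+n}(q^3;q^3)_{m-1} (-q;q)_{m}(-q;q)_{m+n-1}^2 (q;q)_{m+n}}{(q;q)_{m-1} (-q^3;q^3)_{m} (q^3;q^3)_{m+n}} =\frac{1}{6} \frac{(-q;q)_\infty^3}{(-q^3;q^3)_\infty} -\frac{1}{2} \frac{(-q;q)_\infty (q^2;q^2)_\infty}{(q^3;q^3)_\infty} +\frac{1}{3}.$ (d) $\displaystyle\sum_{m\geq 1}\sum_{n\geq 0}\frac{q^{2m+n}(-q^3;q^3)_{m-1}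 (q;q)_{m}(-q;q)_{m+n-1}^2 (-q;q)_{m+n}}{(-q;q)_{m-1} (q^3;q^3)_{m} (-q^3;q^3)_{m+n}} =\frac{-1}{2} \frac{(-q;q)_\infty (q^2;q^2)_\infty}{(q^3;q^3)_\infty} +\frac{1}{6} \frac{(-q;q)_\infty^3}{(-q^3;q^3)_\infty} +\frac{1}{3}.$
   Context: Throughout $q$ is a complex number with $|q|<1$. Standard $q$-Pochhammer notation: $(a;q)_0=1$, $(a;q)_n=\prod_{j=0}^{n-1}(1-aq^j)$, $(a;q)_\infty=\prod_{j\geq 0}(1-aq^j)$, and $(a_1,\ldots,a_k;q)_n=\prod_{j}(a_j;q)_n$. *)

theory Defs
  imports "HOL-Analysis.Analysis"
begin

definition qpoch :: "complex \<Rightarrow> complex \<Rightarrow> nat \<Rightarrow> complex" where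
  "qpoch a q n = (\<Prod>j<n. 1 - a * q ^ j)"

(* The infinite product converges for every a when norm q < 1, so prodinf then has its intended
   value (0 if some factor vanishes). *)
definition qpoch_inf :: "complex \<Rightarrow> complex \<Rightarrow> complex" where
  "qpoch_inf a q = prodinf (\<lambda>j. 1 - a * q ^ j)"

end

theory Submission
  imports Defs
begin

text \<open>
  Put $U_n = (-q;q)_n^3/(-q^3;q^3)_n$, $W_n = (q^3;q^3)_n/((q;q)_n(-q;q)_n^2)$ and $V_n = U_n W_n$.
  With $x = q^n$, the three pairwise differences of the polynomials $(1+x)^2$, $1+x+x^2$ and $1-x+x^2$
  are $x$, $2x$ and $3x$. Hence the consecutive differences of $U$, $V$, $W$ and of their inverses
  are a multiple of $x$ times a quotient of $q$-shifted factorials, and in each of (a)--(d) the summand is,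
  up to a constant, $(F_m - F_{m-1})(G_N - G_{N-1})$ with $N = m+n$ and $F$, $G$ taken from these six
  sequences. Summing over $m \le N$ first leaves $(F_N - F_0)(G_N - G_{N-1})$, and
  $F_N(G_N - G_{N-1})$ is again the difference of a multiple of one of the six.
\<close>

text \<open>Bounded variation is what makes the double series converge absolutely. The nonvanishing
  of the terms and of the limit closes the class under inverses, so membership passes from the four
  basic products to all their quotients.\<close>

definition bv_lim :: "(nat \<Rightarrow> complex) \<Rightarrow> complex \<Rightarrow> bool" where
  "bv_lim f L \<longleftrightarrow> f \<longlonglongrightarrow> L \<and> L \<noteq> 0 \<and> (\<forall>n. f n \<noteq> 0) \<and> summable (\<lambda>n. norm (f (Suc n) - f n))"

lemma summable_norm_Bseq_mult:
  fixes d g :: "nat \<Rightarrow> complex"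
  assumes "summable (\<lambda>n. norm (d n))" "Bseq g"
  shows "summable (\<lambda>n. norm (d n * g n))"
proof -
  obtain K where "\<And>n. norm (g n) \<le> K" using assms(2) by (auto simp: Bseq_def)
  then have "norm (d n * g n) \<le> norm (d n) * K" for n
    by (simp add: norm_mult mult_left_mono)
  then show ?thesis
    by (intro summable_comparison_test'[OF summable_mult2[OF assms(1), of K], of 0]) simp
qed

text \<open>Leibniz rule for differences: f'g' - fg = (f' - f)g' + (g' - g)f, where each summand is
  an absolutely summable sequence times a bounded one.\<close>

lemma bv_lim_mult:
  assumes "bv_lim f L" "bv_lim g M"
  shows "bv_lim (\<lambda>n. f n * g n) (L * M)"
proof -
  have f: "f \<longlonglongrightarrow> L" "summable (\<lambda>n. norm (f (Suc n) - f n))"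
    and g: "g \<longlonglongrightarrow> M" "summable (\<lambda>n. norm (g (Suc n) - g n))"
    using assms by (auto simp: bv_lim_def)
  have "Bseq f" "Bseq (\<lambda>n. g (Suc n))"
    using f(1) g(1) by (auto intro!: convergent_imp_Bseq simp: convergent_def filterlim_sequentially_Suc)
  then have "summable (\<lambda>n. norm ((f (Suc n) - f n) * g (Suc n)) + norm ((g (Suc n) - g n) * f n))"
    using f g by (intro summable_add summable_norm_Bseq_mult)
  moreover have "norm (f (Suc n) * g (Suc n) - f n * g n)
      \<le> norm ((f (Suc n) - f n) * g (Suc n)) + norm ((g (Suc n) - g n) * f n)" for n
    using norm_triangle_ineq[of "(f (Suc n) - f n) * g (Suc n)" "(g (Suc n) - g n) * f n"]
    by (simp add: algebra_simps)
  ultimately have "summable (\<lambda>n. norm (f (Suc n) * g (Suc n) - f n * g n))"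
    by (intro summable_comparison_test[OF _ \<open>summable (\<lambda>n. _ + _)\<close>]) auto
  then show ?thesis
    using assms by (auto simp: bv_lim_def intro: tendsto_mult)
qed

text \<open>The difference of inverses is -(f' - f)/(f f'), and 1/(f f') converges because the limit
  of f is nonzero, hence is bounded.\<close>

lemma bv_lim_inverse:
  assumes "bv_lim f L"
  shows "bv_lim (\<lambda>n. inverse (f n)) (inverse L)"
proof -
  have f: "f \<longlonglongrightarrow> L" "L \<noteq> 0" "\<And>n. f n \<noteq> 0" "summable (\<lambda>n. norm (f (Suc n) - f n))"
    using assms by (auto simp: bv_lim_def)
  have lim: "(\<lambda>n. inverse (f n)) \<longlonglongrightarrow> inverse L"
    using f by (intro tendsto_inverse)
  then have "(\<lambda>n. inverse (f n) * inverse (f (Suc n))) \<longlonglongrightarrow> inverse L * inverse L"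
    by (intro tendsto_mult) (auto simp: filterlim_sequentially_Suc[where f = "\<lambda>n. inverse (f n)"])
  then have "Bseq (\<lambda>n. inverse (f n) * inverse (f (Suc n)))"
    by (auto intro!: convergent_imp_Bseq simp: convergent_def)
  then have "summable (\<lambda>n. norm ((f (Suc n) - f n) * (inverse (f n) * inverse (f (Suc n)))))"
    using f by (intro summable_norm_Bseq_mult)
  moreover have "norm ((f (Suc n) - f n) * (inverse (f n) * inverse (f (Suc n))))
      = norm (inverse (f (Suc n)) - inverse (f n))" for n
  proof -
    have "(f (Suc n) - f n) * (inverse (f n) * inverse (f (Suc n)))
        = - (inverse (f (Suc n)) - inverse (f n))"
      using f(3) by (simp add: field_simps)
    then show ?thesis by (simp only: norm_minus_cancel)
  qed
  ultimately show ?thesis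
    using lim f by (simp add: bv_lim_def)
qed

lemma bv_lim_divide:
  assumes "bv_lim f L" "bv_lim g M"
  shows "bv_lim (\<lambda>n. f n / g n) (L / M)"
  using bv_lim_mult[OF assms(1) bv_lim_inverse[OF assms(2)]] by (simp add: divide_inverse)

lemma bv_lim_power:
  assumes "bv_lim f L"
  shows "bv_lim (\<lambda>n. f n ^ k) (L ^ k)"
proof (induction k)
  case 0
  show ?case by (simp add: bv_lim_def)
next
  case (Suc k)
  then show ?case using bv_lim_mult[OF assms] by simp
qed

section \<open>Convergence of q-shifted factorials\<close>

lemma one_minus_mult_power_nonzero:
  fixes a p :: complex
  assumes "norm a < 1" "norm p < 1"
  shows "1 - a * p ^ j \<noteq> 0"
proof
  assume "1 - a * p ^ j = 0"
  then have "norm (a * p ^ j) = 1" by (metis norm_one right_minus_eq)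
  moreover have "norm (a * p ^ j) \<le> norm a"
    using assms by (simp add: norm_mult norm_power mult_left_le power_le_one)
  ultimately show False using assms(1) by simp
qed

lemma qpoch_0 [simp]: "qpoch a p 0 = 1"
  by (simp add: qpoch_def)

lemma qpoch_Suc: "qpoch a p (Suc n) = qpoch a p n * (1 - a * p ^ n)"
  by (simp add: qpoch_def)

text \<open>Consecutive partial products differ by -a p^n times the n-th one: a geometric term times
  a bounded factor. The limit is nonzero because the product converges and none of its factors
  vanishes.\<close>

lemma bv_lim_qpoch:
  assumes "norm a < 1" "norm p < 1"
  shows "bv_lim (qpoch a p) (qpoch_inf a p)"
proof -
  note nz = one_minus_mult_power_nonzero[OF assms]
  have s: "summable (\<lambda>j. norm (a * p ^ j))"
    using assms(2) by (simp add: norm_mult norm_power summable_mult summable_geometric)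
  then have conv: "convergent_prod (\<lambda>j. 1 - a * p ^ j)"
    by (intro abs_convergent_prod_imp_convergent_prod)
       (simp add: abs_convergent_prod_conv_summable)
  \<comment> \<open>The library limit concerns products over \<open>{..n}\<close>, which have n + 1
    factors, whereas \<open>qpoch a p n\<close> has n; hence the index shift.\<close>
  then have lim: "qpoch a p \<longlonglongrightarrow> qpoch_inf a p"
    using convergent_prod_LIMSEQ[OF conv]
    by (subst filterlim_sequentially_Suc[symmetric]) (simp add: qpoch_def[abs_def] qpoch_inf_def lessThan_Suc_atMost)
  then have "Bseq (qpoch a p)"
    by (auto intro!: convergent_imp_Bseq simp: convergent_def)
  with s have "summable (\<lambda>n. norm (a * p ^ n * qpoch a p n))"
    by (rule summable_norm_Bseq_mult)
  moreover have "norm (a * p ^ n * qpoch a p n) = norm (qpoch a p (Suc n) - qpoch a p n)" for n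
  proof -
    have "a * p ^ n * qpoch a p n = - (qpoch a p (Suc n) - qpoch a p n)"
      by (simp add: qpoch_Suc algebra_simps)
    then show ?thesis by (simp only: norm_minus_cancel)
  qed
  ultimately show ?thesis
    using lim prodinf_nonzero[OF conv nz] nz
    by (simp add: bv_lim_def qpoch_inf_def) (simp add: qpoch_def)
qed

text \<open>Common engine of the four identities. Absolute convergence allows summing first over the
  index of \<open>F\<close>, which telescopes to F(N+1) - F(0); by \<open>FGH\<close> the remaining
  single series telescopes as well, to the limits of \<open>H\<close> and \<open>G\<close>.\<close>

lemma has_sum_double_telescope:
  fixes F G H :: "nat \<Rightarrow> complex"
  assumes F: "bv_lim F LF" and G: "bv_lim G LG" and H: "H \<longlonglongrightarrow> LH"
    and FGH: "\<And>k. F (Suc k) * (G (Suc k) - G k) = H (Suc k) - H k"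
    and t: "\<And>k n. t (Suc k, n) = c * (F (Suc k) - F k) * (G (Suc (k + n)) - G (k + n))"
    and v: "v = c * (LH - H 0 - F 0 * (LG - G 0))"
  shows "(t has_sum v) ({m :: nat. m \<ge> 1} \<times> {n :: nat. n \<ge> 0})"
proof -
  define \<alpha> where "\<alpha> k = F (Suc k) - F k" for k
  define \<beta> where "\<beta> k = G (Suc k) - G k" for k
  \<comment> \<open>Zero-based indices: k stands for m - 1 and N for m + n - 1, so the domain
    becomes the triangle k \<le> N.\<close>
  define s where "s = (\<lambda>(N, k). \<alpha> k * \<beta> N)"
  have \<alpha>: "(\<lambda>k. norm (\<alpha> k)) summable_on UNIV" and \<beta>: "(\<lambda>k. norm (\<beta> k)) summable_on UNIV"
    using F G by (auto simp: bv_lim_def \<alpha>_def \<beta>_def intro!: norm_summable_imp_summable_on)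
  \<comment> \<open>On the full square the terms are products of two absolutely summable sequences;
    the triangle is then a subset.\<close>
  have "(\<lambda>p. norm (s p)) summable_on (UNIV \<times> UNIV)"
    unfolding Infinite_Sum.abs_summable_on_Sigma_iff
  proof (intro conjI ballI)
    show "(\<lambda>k. norm (s (N, k))) summable_on UNIV" for N
      using summable_on_cmult_left[OF \<alpha>, of "norm (\<beta> N)"] by (simp add: s_def norm_mult)
    have "infsum (\<lambda>k. norm (s (N, k))) UNIV = infsum (\<lambda>k. norm (\<alpha> k)) UNIV * norm (\<beta> N)" for N
      by (simp add: s_def norm_mult infsum_cmult_left')
    then show "(\<lambda>N. norm (infsum (\<lambda>k. norm (s (N, k))) UNIV)) summable_on UNIV"
      using summable_on_cmult_right[OF \<beta>] by (simp add: abs_mult infsum_nonneg)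
  qed
  then have "s summable_on Sigma UNIV (\<lambda>N. {..N})"
    by (rule summable_on_subset_banach[OF abs_summable_summable]) auto
  then obtain S where S: "(s has_sum S) (Sigma UNIV (\<lambda>N. {..N}))"
    by (auto simp: summable_on_def)
  have inner: "((\<lambda>k. s (N, k)) has_sum (F (Suc N) - F 0) * \<beta> N) {..N}" for N
  proof -
    have "(\<Sum>k\<le>N. s (N, k)) = (F (Suc N) - F 0) * \<beta> N"
      using sum_lessThan_telescope[of F "Suc N"]
      by (simp add: s_def \<alpha>_def sum_distrib_right[symmetric] lessThan_Suc_atMost)
    then show ?thesis using has_sum_finite[of "{..N}" "\<lambda>k. s (N, k)"] by simp
  qed
  have "(\<lambda>N. (F (Suc N) - F 0) * \<beta> N) sums S"
    by (intro has_sum_imp_sums has_sum_SigmaD[OF S] inner)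
  also have "(\<lambda>N. (F (Suc N) - F 0) * \<beta> N)
      = (\<lambda>N. (H (Suc N) - H N) - F 0 * (G (Suc N) - G N))"
    unfolding FGH[symmetric] \<beta>_def by (simp add: algebra_simps)
  finally have "(\<lambda>N. (H (Suc N) - H N) - F 0 * (G (Suc N) - G N)) sums S" .
  moreover have "(\<lambda>N. (H (Suc N) - H N) - F 0 * (G (Suc N) - G N))
      sums (LH - H 0 - F 0 * (LG - G 0))"
    using G H by (intro sums_diff sums_mult telescope_sums) (simp_all add: bv_lim_def)
  ultimately have "S = LH - H 0 - F 0 * (LG - G 0)"
    by (rule sums_unique2)
  then have "((\<lambda>x. c * s x) has_sum v) (Sigma UNIV (\<lambda>N. {..N}))"
    using has_sum_cmult_right[OF S, of c] by (simp only: v)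
  moreover have "?this \<longleftrightarrow> ?thesis"
    \<comment> \<open>Both truncated subtractions are exact here, since m \<ge> 1 and k \<le>
      N.\<close>
    by (rule has_sum_reindex_bij_witness[of _ "\<lambda>(m, n). (m - 1 + n, m - 1)" "\<lambda>(N, k). (Suc k, N - k)"])
       (auto simp: s_def t \<alpha>_def \<beta>_def)
  ultimately show ?thesis by blast
qed

theorem theorem2p4:
  fixes q :: complex
  assumes "norm q < 1"
  shows
    "((\<lambda>(m, n). q ^ (2 * m + n) * qpoch (- q) q m * qpoch (- q) q (m - 1) ^ 2
          * qpoch (q ^ 3) (q ^ 3) (m + n - 1)
        / (qpoch (- (q ^ 3)) (q ^ 3) m * qpoch q q (m + n - 1) * qpoch (- q) q (m + n) ^ 2))
      has_sum
        (1 / 6 * ((qpoch_inf (- q) q * qpoch_inf (q ^ 3) (q ^ 3))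
                  / (qpoch_inf q q * qpoch_inf (- (q ^ 3)) (q ^ 3)))
         + 1 / 3 * (qpoch_inf (q ^ 3) (q ^ 3)
                  / (qpoch_inf (- q) q * qpoch_inf (q ^ 2) (q ^ 2)))
         - 1 / 2))
      ({m :: nat. m \<ge> 1} \<times> {n :: nat. n \<ge> 0})
   \<and>
    ((\<lambda>(m, n). q ^ (2 * m + n) * qpoch q q m * qpoch (- q) q (m - 1) ^ 2
          * qpoch (- (q ^ 3)) (q ^ 3) (m + n - 1)
        / (qpoch (q ^ 3) (q ^ 3) m * qpoch (- q) q (m + n - 1) * qpoch (- q) q (m + n) ^ 2))
      has_sum
        (- 1 / 2 * ((qpoch_inf q q * qpoch_inf (- (q ^ 3)) (q ^ 3))
                  / (qpoch_inf (- q) q * qpoch_inf (q ^ 3) (q ^ 3)))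
         + 1 / 3 * (qpoch_inf (- (q ^ 3)) (q ^ 3) / qpoch_inf (- q) q ^ 3)
         + 1 / 6))
      ({m :: nat. m \<ge> 1} \<times> {n :: nat. n \<ge> 0})
   \<and>
    ((\<lambda>(m, n). q ^ (2 * m + n) * qpoch (q ^ 3) (q ^ 3) (m - 1) * qpoch (- q) q m
          * qpoch (- q) q (m + n - 1) ^ 2 * qpoch q q (m + n)
        / (qpoch q q (m - 1) * qpoch (- (q ^ 3)) (q ^ 3) m * qpoch (q ^ 3) (q ^ 3) (m + n)))
      has_sum
        (1 / 6 * (qpoch_inf (- q) q ^ 3 / qpoch_inf (- (q ^ 3)) (q ^ 3))
         - 1 / 2 * ((qpoch_inf (- q) q * qpoch_inf (q ^ 2) (q ^ 2))
                  / qpoch_inf (q ^ 3) (q ^ 3))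
         + 1 / 3))
      ({m :: nat. m \<ge> 1} \<times> {n :: nat. n \<ge> 0})
   \<and>
    ((\<lambda>(m, n). q ^ (2 * m + n) * qpoch (- (q ^ 3)) (q ^ 3) (m - 1) * qpoch q q m
          * qpoch (- q) q (m + n - 1) ^ 2 * qpoch (- q) q (m + n)
        / (qpoch (- q) q (m - 1) * qpoch (q ^ 3) (q ^ 3) m * qpoch (- (q ^ 3)) (q ^ 3) (m + n)))
      has_sum
        (- 1 / 2 * ((qpoch_inf (- q) q * qpoch_inf (q ^ 2) (q ^ 2))
                  / qpoch_inf (q ^ 3) (q ^ 3))
         + 1 / 6 * (qpoch_inf (- q) q ^ 3 / qpoch_inf (- (q ^ 3)) (q ^ 3))
         + 1 / 3))
      ({m :: nat. m \<ge> 1} \<times> {n :: nat. n \<ge> 0})"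
proof -

  \<comment> \<open>The four basic products and their limits\<close>
  define P where "P = qpoch (- q) q"
  define Q where "Q = qpoch q q"
  define R where "R = qpoch (- (q ^ 3)) (q ^ 3)"
  define S where "S = qpoch (q ^ 3) (q ^ 3)"
  define LP where "LP = qpoch_inf (- q) q"
  define LQ where "LQ = qpoch_inf q q"
  define LR where "LR = qpoch_inf (- (q ^ 3)) (q ^ 3)"
  define LS where "LS = qpoch_inf (q ^ 3) (q ^ 3)"
  note folds = P_def[symmetric] Q_def[symmetric] R_def[symmetric] S_def[symmetric]
    LP_def[symmetric] LQ_def[symmetric] LR_def[symmetric] LS_def[symmetric]
  have q2: "norm (q ^ 2) < 1" and q3: "norm (q ^ 3) < 1"
    using assms by (simp_all add: norm_power power_less_one_iff)
  have P: "bv_lim P LP" and Q: "bv_lim Q LQ" and R: "bv_lim R LR" and S: "bv_lim S LS"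
    unfolding P_def Q_def R_def S_def LP_def LQ_def LR_def LS_def
    using assms q3 by (auto intro!: bv_lim_qpoch)
  have nz: "P n \<noteq> 0" "Q n \<noteq> 0" "R n \<noteq> 0" "S n \<noteq> 0" "LP \<noteq> 0" "LQ \<noteq> 0" "LR \<noteq> 0" "LS \<noteq> 0" for n
    using P Q R S by (auto simp: bv_lim_def)
  have zero: "P 0 = 1" "Q 0 = 1" "R 0 = 1" "S 0 = 1"
    by (simp_all add: P_def Q_def R_def S_def)

  \<comment> \<open>Factorwise 1 - x^2 = (1 + x)(1 - x); this leaves only the four basic limits on
    the right-hand sides.\<close>
  have LPQ: "qpoch_inf (q ^ 2) (q ^ 2) = LP * LQ"
  proof (rule LIMSEQ_unique)
    have "1 - q ^ 2 * (q ^ 2) ^ j = (1 - (- q) * q ^ j) * (1 - q * q ^ j)" for j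
      by (simp add: algebra_simps power2_eq_square power_mult_distrib)
    then have "qpoch (q ^ 2) (q ^ 2) = (\<lambda>n. P n * Q n)"
      by (simp add: fun_eq_iff qpoch_def P_def Q_def prod.distrib)
    then show "(\<lambda>n. P n * Q n) \<longlonglongrightarrow> qpoch_inf (q ^ 2) (q ^ 2)"
      using bv_lim_qpoch[OF q2 q2] by (simp add: bv_lim_def)
    show "(\<lambda>n. P n * Q n) \<longlonglongrightarrow> LP * LQ"
      using P Q by (auto simp: bv_lim_def intro: tendsto_mult)
  qed

  define X where "X k = q ^ Suc k" for k
  have Suc: "P (Suc k) = P k * (1 + X k)" "Q (Suc k) = Q k * (1 - X k)"
      "R (Suc k) = R k * ((1 + X k) * (1 - X k + X k ^ 2))"
      "S (Suc k) = S k * ((1 - X k) * (1 + X k + X k ^ 2))" for k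
  proof -
    have X3: "q ^ 3 * (q ^ 3) ^ k = X k ^ 3"
      by (metis X_def mult.commute power_Suc power_mult)
    have "1 + X k ^ 3 = (1 + X k) * (1 - X k + X k ^ 2)"
        "1 - X k ^ 3 = (1 - X k) * (1 + X k + X k ^ 2)"
      by (simp_all add: algebra_simps power2_eq_square power3_eq_cube)
    then show "P (Suc k) = P k * (1 + X k)" "Q (Suc k) = Q k * (1 - X k)"
      "R (Suc k) = R k * ((1 + X k) * (1 - X k + X k ^ 2))"
      "S (Suc k) = S k * ((1 - X k) * (1 + X k + X k ^ 2))"
      unfolding P_def Q_def R_def S_def qpoch_Suc minus_mult_left[symmetric] X3
      by (simp_all add: X_def)
  qed
  have Xnz: "1 + X k \<noteq> 0" "1 - X k \<noteq> 0" "1 - X k + X k ^ 2 \<noteq> 0" "1 + X k + X k ^ 2 \<noteq> 0" for k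
    using nz(1)[of "Suc k"] nz(2)[of "Suc k"] nz(3)[of "Suc k"] nz(4)[of "Suc k"]
    unfolding Suc by auto
  \<comment> \<open>Since 2m + n = m + (m + n), the power of q supplies exactly the factor x needed
    by each of the two differences.\<close>
  have qX: "q ^ (2 * Suc k + n) = X k * X (k + n)" for k n
  proof -
    have "2 * Suc k + n = Suc k + Suc (k + n)" by simp
    then show ?thesis by (simp only: X_def power_add)
  qed

  \<comment> \<open>With x = \<open>X k\<close>, the step from k to k + 1 multiplies
    \<open>U\<close>, \<open>V\<close>, \<open>W\<close> by (1+x)^2/(1-x+x^2), (1+x+x^2)/(1-x+x^2)
    and (1+x+x^2)/(1+x)^2 respectively.\<close>
  define U where "U n = P n ^ 3 / R n" for n
  define V where "V n = P n * S n / (Q n * R n)" for n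
  define W where "W n = S n / (Q n * P n ^ 2)" for n
  define LU where "LU = LP ^ 3 / LR"
  define LV where "LV = LP * LS / (LQ * LR)"
  define LW where "LW = LS / (LQ * LP ^ 2)"
  have U: "bv_lim U LU" and V: "bv_lim V LV" and W: "bv_lim W LW"
    unfolding U_def[abs_def] V_def[abs_def] W_def[abs_def] LU_def LV_def LW_def
    by (intro bv_lim_mult bv_lim_divide bv_lim_power P Q R S)+
  have UVW0: "U 0 = 1" "V 0 = 1" "W 0 = 1"
    by (simp_all add: U_def V_def W_def zero)

  have dU: "U (Suc k) - U k = 3 * X k * (P (Suc k) * P k ^ 2 / R (Suc k))" for k
    unfolding U_def Suc using nz Xnz
    by (simp add: divide_simps) (simp add: algebra_simps power2_eq_square power3_eq_cube)
  have dV: "V (Suc k) - V k = 2 * X k * (P (Suc k) * S k / (Q k * R (Suc k)))" for k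
    unfolding V_def Suc using nz Xnz
    by (simp add: divide_simps) (simp add: algebra_simps power2_eq_square power3_eq_cube)
  have dW: "W (Suc k) - W k = - X k * (S k / (Q k * P (Suc k) ^ 2))" for k
    unfolding W_def Suc using nz Xnz
    by (simp add: divide_simps) (simp add: algebra_simps power2_eq_square power3_eq_cube)
  have dU': "inverse (U (Suc k)) - inverse (U k) = - 3 * X k * (R k / (P k * P (Suc k) ^ 2))" for k
    unfolding U_def Suc using nz Xnz
    by (simp add: divide_simps) (simp add: algebra_simps power2_eq_square power3_eq_cube)
  have dV': "inverse (V (Suc k)) - inverse (V k) = - 2 * X k * (Q (Suc k) * R k / (P k * S (Suc k)))" for k
    unfolding V_def Suc using nz Xnz
    by (simp add: divide_simps) (simp add: algebra_simps power2_eq_square power3_eq_cube)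
  have dW': "inverse (W (Suc k)) - inverse (W k) = X k * (P k ^ 2 * Q (Suc k) / S (Suc k))" for k
    unfolding W_def Suc using nz Xnz
    by (simp add: divide_simps) (simp add: algebra_simps power2_eq_square power3_eq_cube)
  note diffs = dU dV dW dU' dV' dW'
  note inverses = bv_lim_inverse[OF U] bv_lim_inverse[OF V] bv_lim_inverse[OF W]
  have lims: "V \<longlonglongrightarrow> LV" "U \<longlonglongrightarrow> LU" "(\<lambda>n. inverse (V n)) \<longlonglongrightarrow> inverse LV"
      "(\<lambda>n. inverse (W n)) \<longlonglongrightarrow> inverse LW"
    using U V inverses by (auto simp: bv_lim_def)

  \<comment> \<open>The four identities\<close>
  show ?thesis
    unfolding folds LPQ
  proof (intro conjI, goal_cases)
    case 1
    show ?case
    \<comment> \<open>In every case \<open>H\<close> is a multiple of the product FG. If the step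
      ratios of F and G are a/b and c/a, that of FG is c/b, so the multiple is (c-a)/(c-b), here
      -x/(2x) = -1/2. The constant \<open>c\<close> of the rule cancels the numerical factors of the
      two differences, here 3 and -1.\<close>
    proof (rule has_sum_double_telescope[OF U W, where c = "- 1 / 3"])
      show "(\<lambda>n. - 1 / 2 * V n) \<longlonglongrightarrow> - 1 / 2 * LV" by (intro tendsto_intros lims)
    next
      fix k
      have "U (Suc k) * (W (Suc k) - W k) = - 1 / 2 * (V (Suc k) - V k)"
        unfolding diffs unfolding U_def V_def W_def Suc using nz Xnz
        by (simp add: divide_simps) (simp add: algebra_simps power2_eq_square power3_eq_cube)
      then show "U (Suc k) * (W (Suc k) - W k) = - 1 / 2 * V (Suc k) - - 1 / 2 * V k"
        by (simp add: algebra_simps)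
    qed (unfold diffs qX split_conv,
         simp add: divide_simps, use nz in
         \<open>simp add: UVW0 LU_def LV_def LW_def field_simps power2_eq_square power3_eq_cube\<close>)
  next
    case 2
    show ?case
    \<comment> \<open>Here FG = 1/V, the multiple is (-3x)/(-2x) = 3/2, and the differences carry
      the factors 1 and -3.\<close>
    proof (rule has_sum_double_telescope[OF inverses(3) inverses(1), where c = "- 1 / 3"])
      show "(\<lambda>n. 3 / 2 * inverse (V n)) \<longlonglongrightarrow> 3 / 2 * inverse LV" by (intro tendsto_intros lims)
    next
      fix k
      have "inverse (W (Suc k)) * (inverse (U (Suc k)) - inverse (U k)) = 3 / 2 * (inverse (V (Suc k)) - inverse (V k))"
        unfolding diffs unfolding U_def V_def W_def Suc using nz Xnz
        by (simp add: divide_simps)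
      then show "inverse (W (Suc k)) * (inverse (U (Suc k)) - inverse (U k)) = 3 / 2 * inverse (V (Suc k)) - 3 / 2 * inverse (V k)"
        by (simp add: algebra_simps)
    qed (unfold diffs qX split_conv,
         simp add: divide_simps, use nz in
         \<open>simp add: UVW0 LU_def LV_def LW_def field_simps power2_eq_square power3_eq_cube\<close>)
  next
    case 3
    show ?case
    \<comment> \<open>Here FG = V/W = U, the multiple is x/(3x) = 1/3, and the differences carry the
      factors 2 and 1.\<close>
    proof (rule has_sum_double_telescope[OF V inverses(3), where c = "1 / 2"])
      show "(\<lambda>n. 1 / 3 * U n) \<longlonglongrightarrow> 1 / 3 * LU" by (intro tendsto_intros lims)
    next
      fix k
      have "V (Suc k) * (inverse (W (Suc k)) - inverse (W k)) = 1 / 3 * (U (Suc k) - U k)"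
        unfolding diffs unfolding U_def V_def W_def Suc using nz Xnz
        by (simp add: divide_simps)
      then show "V (Suc k) * (inverse (W (Suc k)) - inverse (W k)) = 1 / 3 * U (Suc k) - 1 / 3 * U k"
        by (simp add: algebra_simps)
    qed (unfold diffs qX split_conv,
         simp add: divide_simps, use nz in
         \<open>simp add: UVW0 LU_def LV_def LW_def field_simps power2_eq_square power3_eq_cube\<close>)
  next
    case 4
    show ?case
    \<comment> \<open>Here FG = U/V = 1/W, the multiple is 3x/x = 3, and the differences carry the
      factors -2 and 3. The limit agrees with that of the previous case.\<close>
    proof (rule has_sum_double_telescope[OF inverses(2) U, where c = "- 1 / 6"])
      show "(\<lambda>n. 3 * inverse (W n)) \<longlonglongrightarrow> 3 * inverse LW" by (intro tendsto_intros lims)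
    next
      fix k
      have "inverse (V (Suc k)) * (U (Suc k) - U k) = 3 * (inverse (W (Suc k)) - inverse (W k))"
        unfolding diffs unfolding U_def V_def W_def Suc using nz Xnz
        by (simp add: divide_simps)
      then show "inverse (V (Suc k)) * (U (Suc k) - U k) = 3 * inverse (W (Suc k)) - 3 * inverse (W k)"
        by (simp add: algebra_simps)
    qed (unfold diffs qX split_conv,
         simp add: divide_simps, use nz in
         \<open>simp add: UVW0 LU_def LV_def LW_def field_simps power2_eq_square power3_eq_cube\<close>)
  qed
qed

end
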